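(* Let $q>0$, $q\neq1$, and consider the lattice $x(s)=\mathfrak{c}_1q^{-s}+\mathfrak{c}_2q^s+\mathfrak{c}_3$ with $\mathfrak{c}_1,\mathfrak{c}_2,\mathfrak{c}_3\in\mathbb{C}$, $(\mathfrak{c}_1,\mathfrak{c}_2)\neq(0,0)$. Let ${\bf u}\in\mathcal{P}^*$ and suppose that there exists an $x$-admissible pair $(\phi,\psi)\in\mathcal{P}_2\times\mathcal{P}_1$, $\psi(z)=dz+e$, such that $$\mathbf{D}_x(\phi{\bf u})=\mathbf{S}_x(\psi{\bf u}).$$ Set, for $n=0,1,\ldots$, $$d_n:=\tfrac12\phi''\gamma_n+\psi'\alpha_n,\qquad e_n:=\phi'(\mathfrak{c}_3)\gamma_n+\psi(\mathfrak{c}_3)\alpha_n.$$ Then $$R_n{\bf u}=\mathbf{D}_x^n{\bf u}^{[n]}\qquad(n=0,1,\ldots),$$ where $(R_n)_{n\ge0}$ is the simple set of polynomials (i.e. $\deg R_n=n$ for each $n$) given by the three-term recurrence relation $$R_{n+1}(z)=(a_nz-s_n)R_n(z)-t_nR_{n-1}(z)\qquad(n=0,1,\ldots),$$ with initial conditions $R_{-1}=0$ and $R_0=1$, and where $(a_n)_{n\ge0}$, $(s_n)_{n\ge0}$, $(t_n)_{n\ge1}$ are the sequences of complex numbers defined by $$a_n:=-\frac{\alpha\,d_{2n}d_{2n-1}}{d_{n-1}},\qquad s_n:=a_n\left(\mathfrak{c}_3+\frac{\gamma_ne_{n-1}}{d_{2n-2}}-\frac{\gamma_{n+1}e_n}{d_{2n}}\right),\qquad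 t_n:=a_n\,\frac{\alpha\,\gamma_nd_{2n-2}}{d_{2n-1}}\,\phi^{[n-1]}\left(\mathfrak{c}_3-\frac{e_{n-1}}{d_{2n-2}}\right),$$ it being understood that $a_0:=-\alpha d$ and $s_0:=\alpha e$.
   Context: $\mathcal{P}$ is the vector space of complex polynomials in $z$, $\mathcal{P}_n$ the subspace of polynomials of degree at most $n$, $\mathcal{P}^*$ the algebraic dual of $\mathcal{P}$. For $g\in\mathcal{P}$ and ${\bf u}\in\mathcal{P}^*$, $g{\bf u}\in\mathcal{P}^*$ is defined by $\langle g{\bf u},f\rangle:=\langle{\bf u},fg\rangle$. Put $$\alpha:=\frac{q^{1/2}+q^{-1/2}}{2},\quad \alpha_n:=\frac{q^{n/2}+q^{-n/2}}{2},\quad \gamma_n:=\frac{q^{n/2}-q^{-n/2}}{q^{1/2}-q^{-1/2}}.$$ The operators $\mathrm{D}_x,\mathrm{S}_x:\mathcal{P}\to\mathcal{P}$ are defined, for $f\in\mathcal{P}$, as the polynomials satisfying (identically in $s$) $$\mathrm{D}_xf(x(s))=\frac{f(x(s+\frac12))-f(x(s-\frac12))}{x(s+\frac12)-x(s-\frac12)},\qquad \mathrm{S}_xf(x(s))=\frac{f(x(s+\frac12))+f(x(s-\frac12))}{2}.$$ They induce operators on $\mathcal{P}^*$: $\langle\mathbf{D}_x{\bf u},f\rangle:=-\langle{\bf u},\mathrm{D}_xf\rangle$ and $\langle\mathbf{S}_x{\bf u},f\rangle:=\langle{\bf u},\mathrm{S}_xf\rangle$ for $f\in\mathcal{P}$.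 The pair $(\phi,\psi)\in\mathcal{P}_2\times\mathcal{P}_1$ is called $x$-admissible if $\frac12\gamma_n\phi''+\alpha_n\psi'\neq0$ for all $n=0,1,\ldots$. Let $U_1(z):=(\alpha^2-1)(z-\mathfrak{c}_3)$ and $U_2(z):=(\alpha^2-1)\big((z-\mathfrak{c}_3)^2-4\mathfrak{c}_1\mathfrak{c}_2\big)$. Polynomials $\phi^{[k]}\in\mathcal{P}_2$, $\psi^{[k]}\in\mathcal{P}_1$ and functionals ${\bf u}^{[k]}\in\mathcal{P}^*$ are defined recursively by $\phi^{[0]}:=\phi$, $\psi^{[0]}:=\psi$, ${\bf u}^{[0]}:={\bf u}$ and $$\phi^{[k+1]}:=\mathrm{S}_x\phi^{[k]}+U_1\mathrm{S}_x\psi^{[k]}+\alpha U_2\mathrm{D}_x\psi^{[k]},\quad \psi^{[k+1]}:=\mathrm{D}_x\phi^{[k]}+\alpha\mathrm{S}_x\psi^{[k]}+U_1\mathrm{D}_x\psi^{[k]},$$ $${\bf u}^{[k+1]}:=\mathbf{D}_x\big(U_2\psi^{[k]}{\bf u}^{[k]}\big)-\mathbf{S}_x\big(\phi^{[k]}{\bf u}^{[k]}\big)\qquad(k=0,1,\ldots).$$ Explicitly, with $a:=\phi''/2$ and $d:=\psi'$, $\phi^{[k]}(z)=\big(d(\alpha^2-1)\gamma_{2k}+a\alpha_{2k}\big)\big((z-\mathfrak{c}_3)^2-2\mathfrak{c}_1\mathfrak{c}_2\big)+\big(\phi'(\mathfrak{c}_3)\alpha_k+\psi(\mathfrak{c}_3)(\alpha^2-1)\gamma_k\big)(z-\mathfrak{c}_3)+\phi(\mathfrak{c}_3)+2a\mathfrak{c}_1\mathfrak{c}_2$.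 *)

theory Defs
  imports "HOL-Analysis.Analysis" "HOL-Computational_Algebra.Polynomial"
begin

definition poly_dual :: "(complex poly \<Rightarrow> complex) set" where
  "poly_dual = {u. Vector_Spaces.linear smult (*) u}"

definition poly_mult_fun :: "complex poly \<Rightarrow> (complex poly \<Rightarrow> complex) \<Rightarrow> (complex poly \<Rightarrow> complex)"
    (infixr \<open>\<odot>\<close> 75) where
  "g \<odot> u = (\<lambda>f. u (f * g))"

(* The conditions on the parameters are hypotheses of the theorems. *)
locale q_lattice =
  fixes q :: real and c1 c2 c3 :: complex
begin

(* The lattice x(s), for complex s; q^s is taken with the real logarithm of q > 0. *)
definition lat :: "complex \<Rightarrow> complex" where
  "lat s = c1 * complex_of_real q powr (- s) + c2 * complex_of_real q powr s + c3"

definition alpha_seq :: "nat \<Rightarrow> complex" where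
  "alpha_seq n = of_real ((q powr (real n / 2) + q powr (- (real n / 2))) / 2)"

definition \<alpha> :: complex where
  "\<alpha> = of_real ((q powr (1/2) + q powr (- (1/2))) / 2)"

definition gamma_seq :: "nat \<Rightarrow> complex" where
  "gamma_seq n = of_real ((q powr (real n / 2) - q powr (- (real n / 2))) /
                   (q powr (1/2) - q powr (- (1/2))))"

definition is_Dx :: "complex poly \<Rightarrow> complex poly \<Rightarrow> bool" where
  "is_Dx f g \<longleftrightarrow> (\<forall>s. lat (s + 1/2) \<noteq> lat (s - 1/2) \<longrightarrow>
     poly g (lat s) = (poly f (lat (s + 1/2)) - poly f (lat (s - 1/2))) / (lat (s + 1/2) - lat (s - 1/2)))"

definition is_Sx :: "complex poly \<Rightarrow> complex poly \<Rightarrow> bool" where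
  "is_Sx f g \<longleftrightarrow> (\<forall>s. poly g (lat s) = (poly f (lat (s + 1/2)) + poly f (lat (s - 1/2))) / 2)"

(* Existence and uniqueness: is_Dx_ex1 and is_Sx_ex1 below. *)
definition Dx :: "complex poly \<Rightarrow> complex poly" where
  "Dx f = (THE g. is_Dx f g)"

definition Sx :: "complex poly \<Rightarrow> complex poly" where
  "Sx f = (THE g. is_Sx f g)"

definition dual_Dx :: "(complex poly \<Rightarrow> complex) \<Rightarrow> (complex poly \<Rightarrow> complex)" where
  "dual_Dx u = (\<lambda>f. - u (Dx f))"

definition dual_Sx :: "(complex poly \<Rightarrow> complex) \<Rightarrow> (complex poly \<Rightarrow> complex)" where
  "dual_Sx u = (\<lambda>f. u (Sx f))"

definition U1 :: "complex poly" where
  "U1 = smult (\<alpha>\<^sup>2 - 1) [:- c3, 1:]"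

definition U2 :: "complex poly" where
  "U2 = smult (\<alpha>\<^sup>2 - 1) ([:- c3, 1:]\<^sup>2 - [:4 * c1 * c2:])"

(* For phi of degree at most 2 and psi of degree at most 1, phi'' and psi' are
   constants; they are read off by evaluating at 0. *)
definition d_seq :: "complex poly \<Rightarrow> complex poly \<Rightarrow> nat \<Rightarrow> complex" where
  "d_seq \<phi> \<psi> n = 1/2 * poly (pderiv (pderiv \<phi>)) 0 * gamma_seq n + poly (pderiv \<psi>) 0 * alpha_seq n"

definition e_seq :: "complex poly \<Rightarrow> complex poly \<Rightarrow> nat \<Rightarrow> complex" where
  "e_seq \<phi> \<psi> n = poly (pderiv \<phi>) c3 * gamma_seq n + poly \<psi> c3 * alpha_seq n"

definition x_admissible :: "complex poly \<Rightarrow> complex poly \<Rightarrow> bool" where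
  "x_admissible \<phi> \<psi> \<longleftrightarrow> degree \<phi> \<le> 2 \<and> degree \<psi> \<le> 1 \<and>
     (\<forall>n. 1/2 * gamma_seq n * poly (pderiv (pderiv \<phi>)) 0 + alpha_seq n * poly (pderiv \<psi>) 0 \<noteq> 0)"

fun phi_seq psi_seq :: "complex poly \<Rightarrow> complex poly \<Rightarrow> nat \<Rightarrow> complex poly" where
  "phi_seq \<phi> \<psi> 0 = \<phi>"
| "psi_seq \<phi> \<psi> 0 = \<psi>"
| "phi_seq \<phi> \<psi> (Suc k) =
     Sx (phi_seq \<phi> \<psi> k) + U1 * Sx (psi_seq \<phi> \<psi> k) + smult \<alpha> (U2 * Dx (psi_seq \<phi> \<psi> k))"
| "psi_seq \<phi> \<psi> (Suc k) =
     Dx (phi_seq \<phi> \<psi> k) + smult \<alpha> (Sx (psi_seq \<phi> \<psi> k)) + U1 * Dx (psi_seq \<phi> \<psi> k)"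

fun u_seq :: "complex poly \<Rightarrow> complex poly \<Rightarrow> (complex poly \<Rightarrow> complex) \<Rightarrow> nat \<Rightarrow>
    (complex poly \<Rightarrow> complex)" where
  "u_seq \<phi> \<psi> u 0 = u"
| "u_seq \<phi> \<psi> u (Suc k) =
     (\<lambda>f. dual_Dx ((U2 * psi_seq \<phi> \<psi> k) \<odot> u_seq \<phi> \<psi> u k) f
        - dual_Sx (phi_seq \<phi> \<psi> k \<odot> u_seq \<phi> \<psi> u k) f)"

(* The recurrence coefficients a_n, s_n, t_n, where psi(z) = d z + e, i.e. d = coeff psi 1 and
   e = coeff psi 0. The value at index 0 is given separately, so that the (truncated) natural number
   subtractions are only used where they are exact; t_n is only meaningful for n \<ge> 1. *)
definition rec_a :: "complex poly \<Rightarrow> complex poly \<Rightarrow> nat \<Rightarrow> complex" where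
  "rec_a \<phi> \<psi> n = (if n = 0 then - \<alpha> * coeff \<psi> 1
     else - (\<alpha> * d_seq \<phi> \<psi> (2*n) * d_seq \<phi> \<psi> (2*n - 1)) / d_seq \<phi> \<psi> (n - 1))"

definition rec_s :: "complex poly \<Rightarrow> complex poly \<Rightarrow> nat \<Rightarrow> complex" where
  "rec_s \<phi> \<psi> n = (if n = 0 then \<alpha> * coeff \<psi> 0
     else rec_a \<phi> \<psi> n * (c3 + gamma_seq n * e_seq \<phi> \<psi> (n - 1) / d_seq \<phi> \<psi> (2*n - 2)
                            - gamma_seq (n + 1) * e_seq \<phi> \<psi> n / d_seq \<phi> \<psi> (2*n)))"

definition rec_t :: "complex poly \<Rightarrow> complex poly \<Rightarrow> nat \<Rightarrow> complex" where
  "rec_t \<phi> \<psi> n = rec_a \<phi> \<psi> n * (\<alpha> * gamma_seq n * d_seq \<phi> \<psi> (2*n - 2) / d_seq \<phi> \<psi> (2*n - 1)) *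
     poly (phi_seq \<phi> \<psi> (n - 1)) (c3 - e_seq \<phi> \<psi> (n - 1) / d_seq \<phi> \<psi> (2*n - 2))"

(* The second equation is the recurrence for n = 0 with R_{-1} = 0. *)
fun R_poly :: "complex poly \<Rightarrow> complex poly \<Rightarrow> nat \<Rightarrow> complex poly" where
  "R_poly \<phi> \<psi> 0 = 1"
| "R_poly \<phi> \<psi> (Suc 0) = [:- rec_s \<phi> \<psi> 0, rec_a \<phi> \<psi> 0:] * R_poly \<phi> \<psi> 0"
| "R_poly \<phi> \<psi> (Suc (Suc n)) = [:- rec_s \<phi> \<psi> (Suc n), rec_a \<phi> \<psi> (Suc n):] * R_poly \<phi> \<psi> (Suc n)
     - smult (rec_t \<phi> \<psi> (Suc n)) (R_poly \<phi> \<psi> n)"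

context
  assumes q: "q > 0" "q \<noteq> 1" and c: "(c1, c2) \<noteq> (0, 0)"
begin

private definition r :: complex where "r = of_real (q powr (1/2))"

private lemma r: "r \<noteq> 0" "r - 1 / r \<noteq> 0" "2 * \<alpha> = r + 1 / r"
proof -
  have "q powr (1/2) * q powr (1/2) = q" using q by (simp flip: powr_add)
  then have "r * r = of_real q" unfolding r_def by (metis of_real_mult)
  moreover show nz: "r \<noteq> 0" using q by (simp add: r_def)
  ultimately have "r * (r - 1 / r) = of_real q - 1" by (simp add: right_diff_distrib)
  also have "\<dots> \<noteq> 0" using q(2) by simp
  finally show "r - 1 / r \<noteq> 0" by auto
  show "2 * \<alpha> = r + 1 / r" unfolding \<alpha>_def r_def by (simp add: powr_minus_divide)
qed

private lemma shift:
  assumes "X = complex_of_real q powr s"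
  shows "X \<noteq> 0" "lat s = c1 / X + c2 * X + c3"
    "lat (s + 1/2) = c1 / (X * r) + c2 * (X * r) + c3" "lat (s - 1/2) = c1 * r / X + c2 * X / r + c3"
proof -
  have h: "complex_of_real q powr (1/2 :: complex) = r" unfolding r_def
    using powr_of_real[of q "1/2"] q by simp
  have p: "complex_of_real q powr (s + 1/2) = X * r" "complex_of_real q powr (s - 1/2) = X / r"
    unfolding assms by (simp_all add: powr_add powr_diff h)
  show "X \<noteq> 0" unfolding assms using q by simp
  show "lat s = c1 / X + c2 * X + c3" unfolding lat_def powr_minus_divide assms by simp
  show "lat (s + 1/2) = c1 / (X * r) + c2 * (X * r) + c3" "lat (s - 1/2) = c1 * r / X + c2 * X / r + c3"
    unfolding lat_def powr_minus_divide p by simp_all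
qed

private lemma shift_sum: "lat (s + 1/2) + lat (s - 1/2) = 2 * poly [:(1 - \<alpha>) * c3, \<alpha>:] (lat s)"
proof -
  define X where "X = complex_of_real q powr s"
  note S = shift[OF X_def]
  have "2 * poly [:(1 - \<alpha>) * c3, \<alpha>:] (lat s) = (2 - 2 * \<alpha>) * c3 + 2 * \<alpha> * lat s"
    by (simp add: algebra_simps)
  then show ?thesis unfolding r(3) S(2-4) using S(1) r(1) by (simp add: field_simps)
qed

private lemma shift_diff: "(lat (s + 1/2) - lat (s - 1/2))\<^sup>2 = 4 * poly U2 (lat s)"
proof -
  define X where "X = complex_of_real q powr s"
  note S = shift[OF X_def]
  have "lat (s + 1/2) - lat (s - 1/2) = (r - 1 / r) * (c2 * X - c1 / X)"
    unfolding S(3,4) using S(1) r(1) by (simp add: field_simps)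
  then have "(lat (s + 1/2) - lat (s - 1/2))\<^sup>2 = (r - 1 / r)\<^sup>2 * (c2 * X - c1 / X)\<^sup>2"
    by (simp add: power_mult_distrib)
  also have "(r - 1 / r)\<^sup>2 = (2 * \<alpha>)\<^sup>2 - 4"
    unfolding r(3) using r(1) by (simp add: field_simps power2_eq_square)
  also have "(c2 * X - c1 / X)\<^sup>2 = (lat s - c3)\<^sup>2 - 4 * c1 * c2"
    unfolding S(2) using S(1) by (simp add: field_simps power2_eq_square)
  also have "((2 * \<alpha>)\<^sup>2 - 4) * ((lat s - c3)\<^sup>2 - 4 * c1 * c2) = 4 * poly U2 (lat s)"
    by (simp add: U2_def power2_eq_square algebra_simps)
  finally show ?thesis .
qed

private lemma lattice_surj:
  assumes z: "(z - c3)\<^sup>2 \<noteq> 4 * c1 * c2"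
  shows "\<exists>s. lat s = z \<and> lat (s + 1/2) \<noteq> lat (s - 1/2)"
proof -
  define w where "w = csqrt ((z - c3)\<^sup>2 - 4 * c1 * c2)"
  have w: "w\<^sup>2 = (z - c3)\<^sup>2 - 4 * c1 * c2" "w \<noteq> 0" using z unfolding w_def by auto
  have "\<exists>X. X \<noteq> 0 \<and> c1 / X + c2 * X + c3 = z \<and> c2 * X - c1 / X \<noteq> 0"
  proof (cases "c2 = 0")
    case True
    then show ?thesis using c z by (intro exI[of _ "c1 / (z - c3)"]) auto
  next
    case False
    obtain v where v: "v\<^sup>2 = w\<^sup>2" "z - c3 + v \<noteq> 0"
    proof (cases "z - c3 + w = 0")
      case True
      then have "z - c3 + (- w) \<noteq> 0" using w(2) by (auto simp: algebra_simps)
      then show ?thesis using that[of "-w"] by simp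
    qed (use that in auto)
    define X where "X = (z - c3 + v) / (2 * c2)"
    have X: "X \<noteq> 0" using v False by (simp add: X_def)
    have "4 * c1 * c2 = (z - c3)\<^sup>2 - v\<^sup>2" using v w by simp
    also have "\<dots> = (z - c3 + v) * (z - c3 - v)" by (simp add: power2_eq_square algebra_simps)
    also have "\<dots> = 2 * c2 * X * (z - c3 - v)" using False by (simp add: X_def)
    finally have "2 * c2 * (2 * c1) = 2 * c2 * (X * (z - c3 - v))" by (simp add: algebra_simps)
    then have "2 * c1 = X * (z - c3 - v)" using False by simp
    then have "2 * (c1 / X) = z - c3 - v" using X by simp
    then have e: "c1 / X = (z - c3 - v) / 2" by (metis nonzero_mult_div_cancel_left zero_neq_numeral)
    have e2: "c2 * X = (z - c3 + v) / 2" using False by (simp add: X_def)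
    have "v \<noteq> 0" using v w by auto
    moreover have "c1 / X + c2 * X + c3 = z" unfolding e e2 by (simp add: field_simps)
    moreover have "c2 * X - c1 / X = v" unfolding e e2 by (simp add: field_simps)
    ultimately show ?thesis using X by (intro exI[of _ X]) simp
  qed
  then obtain X where X: "X \<noteq> 0" "c1 / X + c2 * X + c3 = z" "c2 * X - c1 / X \<noteq> 0" by blast
  define s where "s = Ln X / of_real (ln q)"
  have Xs: "X = complex_of_real q powr s" using q X(1) by (simp add: powr_def s_def Ln_of_real)
  note S = shift[OF Xs]
  have "lat (s + 1/2) - lat (s - 1/2) = (r - 1 / r) * (c2 * X - c1 / X)"
    unfolding S(3,4) using S(1) r(1) by (simp add: field_simps)
  then show ?thesis using S(2) X r(2) by (intro exI[of _ s]) auto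
qed

private lemma poly_eqI_lattice:
  assumes "\<And>s. lat (s + 1/2) \<noteq> lat (s - 1/2) \<Longrightarrow> poly g (lat s) = poly h (lat s)"
  shows "g = h"
proof (rule ccontr)
  assume "g \<noteq> h"
  define p where "p = (g - h) * ([:- c3, 1:]\<^sup>2 - [:4 * c1 * c2:])"
  have "coeff ([:- c3, 1:]\<^sup>2 - [:4 * c1 * c2:]) 2 = 1"
    by (simp add: power2_eq_square numeral_2_eq_2)
  then have "[:- c3, 1:]\<^sup>2 - [:4 * c1 * c2:] \<noteq> 0" by force
  then have "p \<noteq> 0" using \<open>g \<noteq> h\<close> by (simp only: p_def mult_eq_0_iff) auto
  moreover have "poly p z = 0" for z
  proof (cases "(z - c3)\<^sup>2 = 4 * c1 * c2")
    case True
    then show ?thesis by (simp add: p_def)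
  next
    case False
    then show ?thesis using lattice_surj[OF False] assms by (auto simp: p_def)
  qed
  ultimately show False using poly_all_0_iff_0 by blast
qed

private lemma Dx_Sx_exist:
  "\<exists>g h. (\<forall>s. poly g (lat s) * (lat (s + 1/2) - lat (s - 1/2)) = poly f (lat (s + 1/2)) - poly f (lat (s - 1/2)))
    \<and> (\<forall>s. 2 * poly h (lat s) = poly f (lat (s + 1/2)) + poly f (lat (s - 1/2)))"
proof (induction f)
  case 0
  show ?case by (intro exI[of _ 0]) simp
next
  case (pCons a f)
  then obtain g h where
    g: "\<And>s. poly g (lat s) * (lat (s + 1/2) - lat (s - 1/2)) = poly f (lat (s + 1/2)) - poly f (lat (s - 1/2))" and
    h: "\<And>s. 2 * poly h (lat s) = poly f (lat (s + 1/2)) + poly f (lat (s - 1/2))" by blast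
  define l where "l = [:(1 - \<alpha>) * c3, \<alpha>:]"
  have "poly (l * g + h) (lat s) * (lat (s + 1/2) - lat (s - 1/2))
      = poly (pCons a f) (lat (s + 1/2)) - poly (pCons a f) (lat (s - 1/2))"
    "2 * poly ([:a:] + l * h + U2 * g) (lat s)
      = poly (pCons a f) (lat (s + 1/2)) + poly (pCons a f) (lat (s - 1/2))" for s
  proof -
    define A where "A = lat (s + 1/2)"
    define B where "B = lat (s - 1/2)"
    define L where "L = poly l (lat s)"
    define G where "G = poly g (lat s)"
    define H where "H = poly h (lat s)"
    define W where "W = poly U2 (lat s)"
    have e: "A + B = 2 * L" "(A - B)\<^sup>2 = 4 * W" "G * (A - B) = poly f A - poly f B"
      "2 * H = poly f A + poly f B"
      using shift_sum[of s] shift_diff[of s] g[of s] h[of s]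
      unfolding A_def B_def L_def G_def H_def W_def l_def by auto
    have L: "L = (A + B) / 2" and W: "W = (A - B)\<^sup>2 / 4" and H: "H = (poly f A + poly f B) / 2"
      unfolding e(1) e(2) e(4)[symmetric] by simp_all
    have fA: "poly f A = poly f B + G * (A - B)" using e(3) by simp
    have "(L * G + H) * (A - B) = A * poly f A - B * poly f B"
      unfolding L H fA by (simp add: field_simps)
    moreover have "2 * (a + L * H + W * G) = 2 * a + A * poly f A + B * poly f B"
      unfolding L H W fA by (simp add: field_simps power2_eq_square)
    ultimately show "poly (l * g + h) (lat s) * (lat (s + 1/2) - lat (s - 1/2))
      = poly (pCons a f) (lat (s + 1/2)) - poly (pCons a f) (lat (s - 1/2))"
    "2 * poly ([:a:] + l * h + U2 * g) (lat s)
      = poly (pCons a f) (lat (s + 1/2)) + poly (pCons a f) (lat (s - 1/2))"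
      unfolding A_def B_def L_def G_def H_def W_def by (simp_all add: algebra_simps)
  qed
  then show ?case by blast
qed

lemma is_Dx_ex1: "\<exists>!g. is_Dx f g"
proof -
  from Dx_Sx_exist[of f] obtain g where
    "\<And>s. poly g (lat s) * (lat (s + 1/2) - lat (s - 1/2)) = poly f (lat (s + 1/2)) - poly f (lat (s - 1/2))"
    by blast
  then have "is_Dx f g" unfolding is_Dx_def by (metis eq_iff_diff_eq_0 nonzero_eq_divide_eq)
  then show ?thesis by (rule ex1I) (rule poly_eqI_lattice, use \<open>is_Dx f g\<close> in \<open>simp add: is_Dx_def\<close>)
qed

lemma is_Sx_ex1: "\<exists>!g. is_Sx f g"
proof -
  from Dx_Sx_exist[of f] obtain g where
    g: "\<And>s. 2 * poly g (lat s) = poly f (lat (s + 1/2)) + poly f (lat (s - 1/2))"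
    by blast
  have "is_Sx f g" unfolding is_Sx_def using g by (auto simp: field_simps)
  then show ?thesis by (rule ex1I) (rule poly_eqI_lattice, use \<open>is_Sx f g\<close> in \<open>simp only: is_Sx_def\<close>)
qed

end

end

end

theory Submission
  imports Defs
begin

text \<open>Write $L_k f = \phi^{[k]} D_x f + \psi^{[k]} S_x f$ and
  $A_k f = U_2 \psi^{[k]} D_x f + \phi^{[k]} S_x f$, so that $u^{[k+1]} = -u^{[k]} \circ A_k$ and the
  functional equation says $u \circ L_0 = 0$. In the algebra of operators generated by $D_x$, $S_x$ and
  multiplications, $A_k L_{k+1}$ lies in the right ideal generated by $L_k$; hence
  $u^{[k]} \circ L_k = 0$ for all $k$. Modulo that right ideal one also has
  $A_k D_x \equiv -\alpha \psi^{[k]}$, and $A_{k}(p D_x + \gamma S_x)$ is congruent to a constant for a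
  suitable linear polynomial $p$. Since $D_x^n$ of $(z - c_3) f$ is a combination of
  $S_x D_x^{n-1} f$ and $(z - c_3) D_x^n f$, these congruences are exactly the three-term recurrence for the
  functionals $D_x^n u^{[n]}$, with the coefficients of $R_n$.\<close>

section \<open>Notation, and addition formulas for the hyperbolic sequences\<close>

locale nondegenerate_q_lattice = q_lattice +
  assumes q: "q > 0" "q \<noteq> 1" and c: "(c1, c2) \<noteq> (0, 0)"
begin

definition Y :: "complex poly" where "Y = [:- c3, 1:]"

text \<open>Constants are wrapped as ring elements, so that polynomial identities with symbolic
  coefficients become commutative-ring identities in \<open>Y\<close> and the \<open>K\<close>
  terms, modulo \<open>K_alpha\<close>.\<close>

definition K :: "complex \<Rightarrow> complex poly" where "K k = [:k:]"

definition \<beta> :: complex where "\<beta> = \<alpha>\<^sup>2 - 1"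

definition \<kappa> :: complex where "\<kappa> = 4 * c1 * c2"

lemma K_0: "K 0 = 0"
  and K_1: "K 1 = 1"
  and K_numeral: "K (numeral n) = numeral n"
  and K_add: "K (a + b) = K a + K b"
  and K_diff: "K (a - b) = K a - K b"
  and K_minus: "K (- a) = - K a"
  and K_mult: "K (a * b) = K a * K b"
  and K_power: "K (a ^ m) = K a ^ m"
  by (simp_all add: K_def one_pCons numeral_poly poly_const_pow)

lemmas K_hom = K_0 K_1 K_numeral K_add K_diff K_minus K_mult K_power

lemma smult_eq_K: "smult k f = K k * f"
  by (simp add: K_def)

lemma U1_eq: "U1 = K \<beta> * Y"
  by (simp add: U1_def \<beta>_def Y_def K_def)

lemma U2_eq: "U2 = K \<beta> * (Y\<^sup>2 - K \<kappa>)"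
  by (simp add: U2_def \<beta>_def \<kappa>_def Y_def K_def)

lemma alpha_seq_0 [simp]: "alpha_seq 0 = 1"
  using q by (simp add: alpha_seq_def)

lemma gamma_seq_0 [simp]: "gamma_seq 0 = 0"
  by (simp add: gamma_seq_def)

lemma root_diff_nonzero: "q powr (1/2) - q powr (- (1/2)) \<noteq> 0"
proof -
  have "q powr (1/2) * (q powr (1/2) - q powr (- (1/2))) = q - 1"
    using q by (simp add: right_diff_distrib flip: powr_add)
  then show ?thesis using q by auto
qed

lemma alpha_nonzero: "\<alpha> \<noteq> 0"
proof -
  have "q powr (1/2) + q powr (- (1/2)) > 0" using q by (simp add: add_pos_pos)
  then show ?thesis unfolding \<alpha>_def by (simp only: of_real_eq_0_iff) simp
qed

lemma alpha_seq_1 [simp]: "alpha_seq (Suc 0) = \<alpha>"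
  by (simp add: alpha_seq_def \<alpha>_def)

lemma gamma_seq_1 [simp]: "gamma_seq (Suc 0) = 1"
  using root_diff_nonzero by (simp add: gamma_seq_def)

lemma beta_eq: "\<beta> = of_real (((q powr (1/2) - q powr (- (1/2))) / 2)\<^sup>2)"
proof -
  have "q powr (1/2) * q powr (- (1/2)) = 1" using q by (simp flip: powr_add)
  then have e: "((q powr (1/2) + q powr (- (1/2))) / 2)\<^sup>2 - 1 = ((q powr (1/2) - q powr (- (1/2))) / 2)\<^sup>2"
    by (simp add: power2_eq_square field_simps)
  show ?thesis unfolding \<beta>_def \<alpha>_def e[symmetric] by (simp only: of_real_diff of_real_power of_real_1)
qed

lemma power_half_add:
  "q powr (real (m + n) / 2) = q powr (real m / 2) * q powr (real n / 2)"
  "q powr (- (real (m + n) / 2)) = q powr (- (real m / 2)) * q powr (- (real n / 2))"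
  by (simp_all add: add_divide_distrib flip: powr_add)

text \<open>With t = (ln q)/2, \<open>alpha_seq n\<close> is cosh(n t), \<open>gamma_seq n\<close>
  is sinh(n t)/sinh t and \<beta> is sinh(t)^2. This and \<open>alpha_seq_add\<close> are the
  addition theorems of sinh and cosh.\<close>

lemma gamma_seq_add:
  "gamma_seq (m + n) = gamma_seq m * alpha_seq n + alpha_seq m * gamma_seq n"
proof -
  have "(x * y - x' * y') / h = (x - x') / h * ((y + y') / 2) + (x + x') / 2 * ((y - y') / h)"
    if "h \<noteq> 0" for x y x' y' h :: real
    using that by (simp add: field_simps)
  from this[OF root_diff_nonzero] show ?thesis
    unfolding gamma_seq_def alpha_seq_def of_real_add[symmetric] of_real_mult[symmetric] power_half_add
    by (rule arg_cong)
qed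

lemma alpha_seq_add:
  "alpha_seq (m + n) = alpha_seq m * alpha_seq n + \<beta> * gamma_seq m * gamma_seq n"
proof -
  have "(x * y + x' * y') / 2 = (x + x') / 2 * ((y + y') / 2) + (h / 2)\<^sup>2 * ((x - x') / h) * ((y - y') / h)"
    if "h \<noteq> 0" for x y x' y' h :: real
    using that by (simp add: field_simps power2_eq_square)
  from this[OF root_diff_nonzero] show ?thesis
    unfolding gamma_seq_def alpha_seq_def beta_eq of_real_add[symmetric] of_real_mult[symmetric] power_half_add
    by (rule arg_cong)
qed


section \<open>Calculus of the operators \<open>Dx\<close> and \<open>Sx\<close>\<close>

lemma poly_eqI_lattice:
  assumes "\<And>s. lat (s + 1/2) \<noteq> lat (s - 1/2) \<Longrightarrow> poly g (lat s) = poly h (lat s)"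
  shows "g = h"
proof -
  \<comment> \<open>A polynomial vanishing at all lattice values with nonzero step is a divided
    difference of 0, so uniqueness of divided differences serves as an identity principle.\<close>
  have "is_Dx 0 (g - h)" "is_Dx 0 0" using assms by (simp_all add: is_Dx_def)
  then have "g - h = 0" using is_Dx_ex1[OF q c, of 0] by blast
  then show ?thesis by simp
qed

lemma poly_Dx: "poly (Dx f) (lat s) * (lat (s + 1/2) - lat (s - 1/2)) = poly f (lat (s + 1/2)) - poly f (lat (s - 1/2))"
  using theI'[OF is_Dx_ex1[OF q c, of f]] unfolding Dx_def[symmetric]
  by (cases "lat (s + 1/2) = lat (s - 1/2)") (simp_all add: is_Dx_def)

lemma poly_Sx: "poly (Sx f) (lat s) = (poly f (lat (s + 1/2)) + poly f (lat (s - 1/2))) / 2"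
proof -
  have "is_Sx f (Sx f)" unfolding Sx_def by (rule theI'[OF is_Sx_ex1[OF q c]])
  then show ?thesis unfolding is_Sx_def by blast
qed

lemma Dx_eqI:
  assumes "\<And>s. poly g (lat s) * (lat (s + 1/2) - lat (s - 1/2)) = poly f (lat (s + 1/2)) - poly f (lat (s - 1/2))"
  shows "Dx f = g"
proof (rule poly_eqI_lattice)
  fix s
  assume "lat (s + 1/2) \<noteq> lat (s - 1/2)"
  then show "poly (Dx f) (lat s) = poly g (lat s)"
    using assms[of s] poly_Dx[of f s] by (metis mult_right_cancel right_minus_eq)
qed

lemma Sx_eqI:
  assumes "\<And>s. poly g (lat s) = (poly f (lat (s + 1/2)) + poly f (lat (s - 1/2))) / 2"
  shows "Sx f = g"
  by (rule poly_eqI_lattice) (simp add: assms poly_Sx)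

lemma Dx_add: "Dx (f + g) = Dx f + Dx g"
  by (rule Dx_eqI) (simp add: distrib_right poly_Dx)

lemma Sx_add: "Sx (f + g) = Sx f + Sx g"
  by (rule Sx_eqI) (simp add: poly_Sx add_divide_distrib)

lemma Dx_const: "Dx (K k) = 0"
  by (rule Dx_eqI) (simp add: K_def)

lemma Sx_const: "Sx (K k) = K k"
  by (rule Sx_eqI) (simp add: K_def)

lemma Dx_diff: "Dx (f - g) = Dx f - Dx g"
  using Dx_add[of "f - g" g] by simp

lemma Sx_diff: "Sx (f - g) = Sx f - Sx g"
  using Sx_add[of "f - g" g] by simp

text \<open>With X = q^s and r = q^(1/2), the step factors as (r - 1/r)(c2 X - c1/X). Its square is
  polynomial in \<open>lat s\<close> because (c2 X - c1/X)^2 = (c2 X + c1/X)^2 - 4 c1 c2; this is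
  the origin of \<open>U2\<close>.\<close>

lemma lat_midpoint:
  "lat (s + 1/2) + lat (s - 1/2) - 2 * c3 = 2 * \<alpha> * (lat s - c3)"
  "(lat (s + 1/2) - lat (s - 1/2))\<^sup>2 = 4 * poly U2 (lat s)"
proof -
  define r :: complex where "r = of_real (q powr (1/2))"
  define X where "X = complex_of_real q powr s"
  have r: "r \<noteq> 0" and X: "X \<noteq> 0" using q by (simp_all add: r_def X_def)
  have \<alpha>: "\<alpha> = (r + 1 / r) / 2" unfolding \<alpha>_def r_def by (simp add: powr_minus_divide)
  have h: "complex_of_real q powr (1/2 :: complex) = r" unfolding r_def
    using powr_of_real[of q "1/2"] q by simp
  have p: "complex_of_real q powr (s + 1/2) = X * r" "complex_of_real q powr (s - 1/2) = X / r"
    unfolding X_def by (simp_all add: powr_add powr_diff h)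
  have l: "lat s = c1 / X + c2 * X + c3" "lat (s + 1/2) = c1 / (X * r) + c2 * (X * r) + c3"
    "lat (s - 1/2) = c1 * r / X + c2 * X / r + c3"
    unfolding lat_def powr_minus_divide p by (simp_all add: X_def)
  show "lat (s + 1/2) + lat (s - 1/2) - 2 * c3 = 2 * \<alpha> * (lat s - c3)"
    unfolding l \<alpha> using r X by (simp add: field_simps)
  have "lat (s + 1/2) - lat (s - 1/2) = (r - 1 / r) * (c2 * X - c1 / X)"
    unfolding l using r X by (simp add: field_simps)
  then have "(lat (s + 1/2) - lat (s - 1/2))\<^sup>2 = (r - 1 / r)\<^sup>2 * (c2 * X - c1 / X)\<^sup>2"
    by (simp add: power_mult_distrib)
  also have "(r - 1 / r)\<^sup>2 = 4 * (\<alpha>\<^sup>2 - 1)"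
    unfolding \<alpha> using r by (simp add: field_simps power2_eq_square)
  also have "(c2 * X - c1 / X)\<^sup>2 = (lat s - c3)\<^sup>2 - 4 * c1 * c2"
    unfolding l using X by (simp add: field_simps power2_eq_square)
  finally show "(lat (s + 1/2) - lat (s - 1/2))\<^sup>2 = 4 * poly U2 (lat s)"
    by (simp add: U2_def power2_eq_square algebra_simps)
qed

lemma Dx_Y: "Dx Y = 1"
  by (rule Dx_eqI) (simp add: Y_def)

lemma Sx_Y: "Sx Y = K \<alpha> * Y"
proof (rule Sx_eqI)
  fix s
  show "poly (K \<alpha> * Y) (lat s) = (poly Y (lat (s + 1/2)) + poly Y (lat (s - 1/2))) / 2"
    using lat_midpoint(1)[of s] by (simp add: Y_def K_def field_simps)
qed

lemma Dx_mult: "Dx (f * g) = Dx f * Sx g + Sx f * Dx g"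
proof (rule Dx_eqI)
  fix s
  show "poly (Dx f * Sx g + Sx f * Dx g) (lat s) * (lat (s + 1/2) - lat (s - 1/2))
    = poly (f * g) (lat (s + 1/2)) - poly (f * g) (lat (s - 1/2))" (is "_ * ?h = _")
  proof -
    have "poly (Dx f * Sx g + Sx f * Dx g) (lat s) * ?h
      = (poly (Dx f) (lat s) * ?h) * poly (Sx g) (lat s) + poly (Sx f) (lat s) * (poly (Dx g) (lat s) * ?h)"
      by (simp add: algebra_simps)
    also have "\<dots> = poly (f * g) (lat (s + 1/2)) - poly (f * g) (lat (s - 1/2))"
      unfolding poly_Dx poly_Sx poly_mult by (simp add: field_simps)
    finally show ?thesis .
  qed
qed

text \<open>The mean of a product is the product of the means plus a quarter of the product of the
  differences, and the squared step is 4 \<open>U2\<close>.\<close>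

lemma Sx_mult: "Sx (f * g) = U2 * Dx f * Dx g + Sx f * Sx g"
proof (rule Sx_eqI)
  fix s
  show "poly (U2 * Dx f * Dx g + Sx f * Sx g) (lat s)
    = (poly (f * g) (lat (s + 1/2)) + poly (f * g) (lat (s - 1/2))) / 2"
  proof -
    let ?h = "lat (s + 1/2) - lat (s - 1/2)"
    have "4 * poly (U2 * Dx f * Dx g) (lat s) = (4 * poly U2 (lat s)) * poly (Dx f) (lat s) * poly (Dx g) (lat s)"
      by (simp add: mult.assoc)
    also have "\<dots> = (poly (Dx f) (lat s) * ?h) * (poly (Dx g) (lat s) * ?h)"
      unfolding lat_midpoint(2)[symmetric] by (simp only: power2_eq_square ac_simps)
    finally have e: "poly (U2 * Dx f * Dx g) (lat s) = \<dots> / 4"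
      by (simp only: eq_divide_eq_numeral1(1) mult.commute) simp
    show ?thesis unfolding poly_add e unfolding poly_mult poly_Dx poly_Sx by (simp add: field_simps)
  qed
qed

text \<open>Induction by powers of \<open>Y\<close> instead of z, as \<open>Dx\<close> and
  \<open>Sx\<close> act diagonally enough on \<open>Y\<close> for the product rules to apply; the
  shift by c3 is absorbed by the case of constant multiples.\<close>

lemma poly_induct_Y [case_names const add mult_Y mult_K]:
  assumes "\<And>k. P (K k)" "\<And>f g. P f \<Longrightarrow> P g \<Longrightarrow> P (f + g)" "\<And>f. P f \<Longrightarrow> P (Y * f)"
    "\<And>k f. P f \<Longrightarrow> P (K k * f)"
  shows "P f"
proof (induction f)
  case 0
  show ?case using assms(1)[of 0] by (simp add: K_0)
next
  case (pCons k f)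
  have "pCons k f = (K k + K c3 * f) + Y * f" by (simp add: Y_def K_def)
  then show ?case using assms pCons by metis
qed

lemma Dx_numeral: "Dx 0 = 0" "Dx 1 = 0" "Dx (numeral n) = 0"
  using Dx_const[of 0] Dx_const[of 1] Dx_const[of "numeral n"] by (simp_all add: K_hom)

lemma Sx_numeral: "Sx 0 = 0" "Sx 1 = 1" "Sx (numeral n) = numeral n"
  using Sx_const[of 0] Sx_const[of 1] Sx_const[of "numeral n"] by (simp_all add: K_hom)

lemma Dx_minus: "Dx (- f) = - Dx f"
  using Dx_diff[of 0 f] by (simp add: Dx_numeral)

lemma Sx_minus: "Sx (- f) = - Sx f"
  using Sx_diff[of 0 f] by (simp add: Sx_numeral)

lemmas Dx_simps = Dx_add Dx_diff Dx_minus Dx_mult Dx_const Dx_Y Dx_numeral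
lemmas Sx_simps = Sx_add Sx_diff Sx_minus Sx_mult Sx_const Sx_Y Sx_numeral

lemma K_alpha: "K \<alpha> * K \<alpha> = K \<beta> + 1"
  by (simp add: \<beta>_def power2_eq_square flip: K_hom)

lemma Dx_U1: "Dx U1 = K \<beta>"
  by (simp add: U1_eq Dx_simps Sx_simps)

lemma Sx_U1: "Sx U1 = K \<alpha> * U1"
  by (simp add: U1_eq Dx_simps Sx_simps)

text \<open>The two identities are proved together: by the product rules, each of them for
  \<open>Y * f\<close> involves both \<open>Dx (Sx f)\<close> and \<open>Sx (Sx f)\<close>.\<close>

lemma Dx_Sx_commute: "Dx (Sx f) = K \<alpha> * Sx (Dx f) + U1 * Dx (Dx f)"
  and Sx_Sx: "Sx (Sx f) = U1 * Sx (Dx f) + K \<alpha> * U2 * Dx (Dx f) + f"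
proof (induction f rule: poly_induct_Y)
  case (mult_Y f)
  case 1
  show ?case
    unfolding Dx_simps Sx_simps mult_Y U1_eq U2_eq power2_eq_square
    using K_alpha by algebra
  case 2
  show ?case
    unfolding Dx_simps Sx_simps mult_Y U1_eq U2_eq power2_eq_square
    using K_alpha by algebra
qed (simp_all add: Dx_simps Sx_simps algebra_simps)

section \<open>The operators L and A for an arbitrary pair\<close>

definition pearson :: "complex poly \<Rightarrow> complex poly \<Rightarrow> complex poly \<Rightarrow> complex poly" where
  "pearson \<phi> \<psi> f = \<phi> * Dx f + \<psi> * Sx f"

text \<open>For the pair at level k, \<open>pearson\<close> is L_k and \<open>raise\<close> is A_k.
  Keeping the pair generic lets the passage from k to k + 1 be treated once.\<close>

definition raise :: "complex poly \<Rightarrow> complex poly \<Rightarrow> complex poly \<Rightarrow> complex poly" where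
  "raise \<phi> \<psi> f = U2 * \<psi> * Dx f + \<phi> * Sx f"

definition phi_next :: "complex poly \<Rightarrow> complex poly \<Rightarrow> complex poly" where
  "phi_next \<phi> \<psi> = Sx \<phi> + U1 * Sx \<psi> + smult \<alpha> (U2 * Dx \<psi>)"

definition psi_next :: "complex poly \<Rightarrow> complex poly \<Rightarrow> complex poly" where
  "psi_next \<phi> \<psi> = Dx \<phi> + smult \<alpha> (Sx \<psi>) + U1 * Dx \<psi>"

lemma raise_K_mult: "raise \<phi> \<psi> (K k * f) = K k * raise \<phi> \<psi> f"
  and raise_diff: "raise \<phi> \<psi> (f - g) = raise \<phi> \<psi> f - raise \<phi> \<psi> g"
  and pearson_K_mult: "pearson \<phi> \<psi> (K k * f) = K k * pearson \<phi> \<psi> f"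
  by (simp_all add: raise_def pearson_def Dx_simps Sx_simps algebra_simps)

text \<open>The operator T = \<alpha> Sx - U1 Dx undoes the commutation rules: Dx T = Sx Dx and Sx T
  = U2 Dx Dx + \<alpha>. Hence L T exceeds A Dx exactly by \<alpha> \<psi>.\<close>

lemma raise_Dx:
  "raise \<phi> \<psi> (Dx f) = pearson \<phi> \<psi> (K \<alpha> * Sx f - U1 * Dx f) - K \<alpha> * \<psi> * f"
  unfolding raise_def pearson_def Dx_simps Sx_simps Dx_U1 Sx_U1 Dx_Sx_commute Sx_Sx
  using K_alpha by algebra

text \<open>The conditions come from comparing coefficients of $S_x S_x f$, $D_x S_x f$, $S_x D_x f$ and
  $D_x D_x f$; comparison alone leaves a multiple $\lambda$ of $\psi$ and $\phi$ free in the first two, and the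
  leading coefficients force $\lambda = \alpha$.\<close>

lemma raise_pearson:
  assumes "Dx \<sigma> = Sx \<psi>' - K \<alpha> * \<psi>" "Sx \<sigma> = U2 * Dx \<psi>' + K \<alpha> * \<phi>"
    "Dx \<tau> = Sx \<phi>' - K \<alpha> * (K \<alpha> * \<phi> - U1 * \<psi>)" "Sx \<tau> = U2 * Dx \<phi>' + K \<alpha> * (K \<alpha> * U2 * \<psi> - U1 * \<phi>)"
  shows "raise \<phi> \<psi> (pearson \<phi>' \<psi>' f) = pearson \<phi> \<psi> (\<sigma> * Sx f + \<tau> * Dx f)"
  unfolding raise_def pearson_def Dx_simps Sx_simps Dx_Sx_commute Sx_Sx assms
  by algebra

text \<open>Both sides reduce to combinations of g, \<open>Sx (Dx g)\<close> and
  \<open>Dx (Dx g)\<close>. The third condition compares the coefficients of g; the first two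
  compare the \<phi> parts of the other coefficients, and the \<psi> parts then agree as
  well.\<close>

lemma raise_eq_pearson:
  assumes "Dx \<tau> = Sx p + (K \<gamma> - Dx \<sigma>) * U1 - K \<alpha> * Sx \<sigma>"
    "Sx \<tau> = U2 * (Dx p + K \<alpha> * (K \<gamma> - Dx \<sigma>)) - U1 * Sx \<sigma>"
    "K \<gamma> * \<phi> - K t = \<phi> * Dx \<sigma> + \<psi> * Sx \<sigma>"
  shows "raise \<phi> \<psi> (p * Dx g + K \<gamma> * Sx g) - K t * g = pearson \<phi> \<psi> (\<sigma> * Sx g + \<tau> * Dx g)"
proof -
  have t: "K t = K \<gamma> * \<phi> - (\<phi> * Dx \<sigma> + \<psi> * Sx \<sigma>)" using assms(3) by (simp add: algebra_simps)
  show ?thesis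
    unfolding raise_def pearson_def Dx_simps Sx_simps Dx_Sx_commute Sx_Sx t assms(1,2)
    by algebra
qed

section \<open>Coordinates for degree at most two, and one step of the recursion\<close>

definition quad :: "complex \<Rightarrow> complex \<Rightarrow> complex \<Rightarrow> complex poly" where
  "quad a b c = K a * (Y * Y) + K b * Y + K c"

definition lin :: "complex \<Rightarrow> complex \<Rightarrow> complex poly" where
  "lin d e = K d * Y + K e"

text \<open>With constants, linear polynomials, \<open>U1\<close> and \<open>U2\<close> in common
  coordinates, an identity between polynomials of degree at most two splits into three scalar
  identities.\<close>

lemma K_eq_quad: "K k = quad 0 0 k"
  and lin_eq_quad: "lin d e = quad 0 d e"
  and U1_eq_quad: "U1 = quad 0 \<beta> 0"
  and U2_eq_quad: "U2 = quad \<beta> 0 (- \<beta> * \<kappa>)"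
  by (simp_all add: quad_def lin_def U1_eq U2_eq K_hom power2_eq_square right_diff_distrib)

lemma quad_add: "quad a b c + quad a' b' c' = quad (a + a') (b + b') (c + c')"
  and quad_diff: "quad a b c - quad a' b' c' = quad (a - a') (b - b') (c - c')"
  and K_mult_quad: "quad 0 0 k * quad a b c = quad (k * a) (k * b) (k * c)"
  and quad_mult_K: "quad a b c * quad 0 0 k = quad (a * k) (b * k) (c * k)"
  and lin_mult_lin: "quad 0 d e * quad 0 d' e' = quad (d * d') (d * e' + e * d') (e * e')"
  by (simp_all add: quad_def K_hom algebra_simps)

lemma Dx_quad: "Dx (quad a b c) = quad 0 (2 * \<alpha> * a) b"
  and Sx_quad: "Sx (quad a b c) = quad ((\<alpha>\<^sup>2 + \<beta>) * a) (\<alpha> * b) (c - \<beta> * \<kappa> * a)"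
  by (simp_all add: quad_def K_hom Dx_simps Sx_simps U2_eq power2_eq_square algebra_simps)

lemma quad_cong: "a = a' \<Longrightarrow> b = b' \<Longrightarrow> c = c' \<Longrightarrow> quad a b c = quad a' b' c'"
  by simp

lemmas quad_simps = K_eq_quad lin_eq_quad U1_eq_quad U2_eq_quad Dx_quad Sx_quad
  quad_add quad_diff K_mult_quad quad_mult_K lin_mult_lin
  mult_zero_left mult_zero_right diff_zero add_0 add_0_right

text \<open>Here 2 \<alpha> = gamma_2 and 2 \<alpha>^2 - 1 = alpha_2: in this lemma and the next,
  the leading coefficients advance by two indices and the middle ones by one.\<close>

lemma psi_next_quad:
  "psi_next (quad a b c) (lin d e) = lin (2 * \<alpha> * a + (2 * \<alpha>\<^sup>2 - 1) * d) (b + \<alpha> * e)"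
  unfolding psi_next_def quad_def lin_def Dx_simps Sx_simps U1_eq U2_eq smult_eq_K K_hom power2_eq_square
  using K_alpha by algebra

lemma phi_next_quad:
  "phi_next (quad a b c) (lin d e) =
   quad ((2 * \<alpha>\<^sup>2 - 1) * a + 2 * \<alpha> * \<beta> * d) (\<alpha> * b + \<beta> * e) (c - \<beta> * \<kappa> * (a + \<alpha> * d))"
  unfolding phi_next_def quad_def lin_def Dx_simps Sx_simps U1_eq U2_eq smult_eq_K K_hom power2_eq_square
  using K_alpha by algebra

lemma pearson_next:
  "\<exists>g. raise (quad a b c) (lin d e) (pearson (phi_next (quad a b c) (lin d e)) (psi_next (quad a b c) (lin d e)) f)
     = pearson (quad a b c) (lin d e) g"
proof -
  \<comment> \<open>The witnesses solve the four equations of \<open>raise_pearson\<close>: the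
    \<open>Dx\<close> equations determine the nonconstant coefficients and the \<open>Sx\<close>
    equations fix the constant ones.\<close>
  define \<sigma> where "\<sigma> = K (\<alpha> * a + \<beta> * d) * (Y * Y) + K b * Y + K (\<alpha> * c - \<alpha> * \<beta> * \<kappa> * (a + \<alpha> * d))"
  define \<tau> where "\<tau> = K (\<beta> * (a + \<alpha> * d)) * (Y * Y * Y) + K (\<beta> * e) * (Y * Y)
     + K (- \<beta> * c - \<beta> * \<kappa> * ((1 + \<alpha>\<^sup>2) * a + \<alpha> ^ 2 * \<alpha> * d)) * Y + K (- \<beta> * \<kappa> * (\<alpha> * b + \<alpha>\<^sup>2 * e))"
  note defs = \<sigma>_def \<tau>_def quad_def lin_def Dx_simps Sx_simps U1_eq U2_eq K_hom power2_eq_square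
  show ?thesis
  proof (rule exI, rule raise_pearson)
    show "Dx \<sigma> = Sx (psi_next (quad a b c) (lin d e)) - K \<alpha> * lin d e"
      unfolding phi_next_quad psi_next_quad unfolding defs using K_alpha by algebra
    show "Sx \<sigma> = U2 * Dx (psi_next (quad a b c) (lin d e)) + K \<alpha> * quad a b c"
      unfolding phi_next_quad psi_next_quad unfolding defs using K_alpha by algebra
    show "Dx \<tau> = Sx (phi_next (quad a b c) (lin d e)) - K \<alpha> * (K \<alpha> * quad a b c - U1 * lin d e)"
      unfolding phi_next_quad psi_next_quad unfolding defs using K_alpha by algebra
    show "Sx \<tau> = U2 * Dx (phi_next (quad a b c) (lin d e))
      + K \<alpha> * (K \<alpha> * U2 * lin d e - U1 * quad a b c)"
      unfolding phi_next_quad psi_next_quad unfolding defs using K_alpha by algebra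
  qed
qed

text \<open>The scalar core of the recurrence at n = k + 1. Intended values: a, b, c and d, e are
  the coefficients of phi^[k] and psi^[k] in powers of \<open>Y\<close>; A, \<gamma> are
  alpha_{k+1}, gamma_{k+1}; \<open>d1\<close>, \<open>d2\<close>, \<open>dk\<close> are d_{2k+1},
  d_{2k+2}, d_k; and m, s, t are a_n, s_n - a_n c3, t_n. The summand with
  \<open>lin d2 (b + \<alpha> * e)\<close> is the \<alpha> psi^[k+1] that \<open>raise_Dx\<close>
  produces one level up.\<close>

lemma raise_next:
  fixes A \<gamma> a b c d e s t :: complex
  defines "d1 \<equiv> a + \<alpha> * d" and "d2 \<equiv> 2 * \<alpha> * a + (2 * \<alpha>\<^sup>2 - 1) * d"
    and "dk \<equiv> a * (A - \<alpha> * \<gamma>) + d * (\<alpha> * A - \<beta> * \<gamma>)"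
  defines "m \<equiv> - \<alpha> * d2 * d1 / dk"
  assumes nz: "d \<noteq> 0" "d1 \<noteq> 0" "d2 \<noteq> 0" "dk \<noteq> 0"
    and s: "s = m * (\<gamma> * e / d - (\<alpha> * \<gamma> + A) * (b + \<alpha> * e) / d2)"
    and t: "t = m * (\<alpha> * \<gamma> * d / d1) * (a * (e / d)\<^sup>2 - b * (e / d) + c)"
  shows "\<exists>f. raise (quad a b c) (lin d e) (K \<alpha> * lin d2 (b + \<alpha> * e) * Dx g + (lin (m * A) (- s) * Dx g + K (m * \<gamma>) * Sx g))
    - K t * g = pearson (quad a b c) (lin d e) f"
proof -
  \<comment> \<open>After division by m, the conditions of \<open>raise_eq_pearson\<close> are
    solved with \<sigma> linear and \<tau> quadratic. The Y^2 and Y coefficients of the third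
    condition give \<open>s1\<close> and \<open>s0\<close>; at the zero -e/d of \<psi> (in the
    variable \<open>Y\<close>) it gives t/m = (\<gamma> - s1) \<phi>(-e/d). The first two conditions
    then give h, \<open>p1\<close>, \<open>p0\<close> and \<tau>.\<close>
  define G where "G = \<gamma> * \<alpha> * d / d1"
  define s1 where "s1 = \<gamma> * a / d1"
  define s0 where "s0 = \<gamma> * \<alpha> * (b * d - a * e) / (d * d1)"
  define h where "h = \<beta> * G / \<alpha>"
  define p1 where "p1 = h + \<alpha> * s1"
  define p0 where "p0 = s0 / \<alpha>"
  define \<sigma> where "\<sigma> = lin s1 s0"
  define \<tau> where "\<tau> = quad h (- \<beta> * p0) (\<beta> * \<kappa> * (h - p1 - \<alpha> * G))"
  \<comment> \<open>The scale m is chosen for this matching of leading coefficients;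
    \<open>p0\<close> below does the same for the constant terms and s.\<close>
  have p1: "\<alpha> * d2 + m * A = m * p1"
  proof -
    have "p1 * d1 = \<beta> * \<gamma> * d + \<alpha> * \<gamma> * a"
      using nz alpha_nonzero unfolding p1_def h_def G_def s1_def by (simp add: field_simps)
    then have dk: "dk = d1 * A - p1 * d1" unfolding dk_def d1_def by (simp add: algebra_simps)
    have "m * (p1 - A) = \<alpha> * d2 * (d1 * A - p1 * d1) / dk"
      unfolding m_def using nz by (simp add: field_simps)
    also have "\<dots> = \<alpha> * d2" unfolding dk[symmetric] using nz by simp
    finally show ?thesis by (simp add: algebra_simps)
  qed
  have p0: "\<alpha> * (b + \<alpha> * e) - s = m * p0"
  proof -
    \<comment> \<open>For the intended values: gamma_{k+1} d_{2k+2} = gamma_{k+2} d_{2k+1} -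
      d_k.\<close>
    have "\<gamma> * d2 = (\<alpha> * \<gamma> + A) * d1 - dk"
      unfolding d2_def d1_def dk_def \<beta>_def by (simp add: algebra_simps power2_eq_square)
    then have e: "dk = (\<alpha> * \<gamma> + A) * d1 - \<gamma> * d2" by simp
    have "\<alpha> = - m * dk / (d1 * d2)" using nz unfolding m_def by simp
    then have "\<alpha> * (b + \<alpha> * e) - s
      = m * (- dk / (d1 * d2) * (b + \<alpha> * e) - (\<gamma> * e / d - (\<alpha> * \<gamma> + A) * (b + \<alpha> * e) / d2))"
      unfolding s by (simp add: algebra_simps)
    also have "- dk / (d1 * d2) * (b + \<alpha> * e) - (\<gamma> * e / d - (\<alpha> * \<gamma> + A) * (b + \<alpha> * e) / d2)
      = \<gamma> * (d * (b + \<alpha> * e) - e * d1) / (d * d1)"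
      unfolding e using nz by (simp add: field_simps)
    also have "\<dots> = p0"
    proof -
      have "d * (b + \<alpha> * e) - e * d1 = b * d - a * e" unfolding d1_def by (simp add: algebra_simps)
      then show ?thesis using alpha_nonzero by (simp add: p0_def s0_def)
    qed
    finally show ?thesis .
  qed
  have G: "\<gamma> - s1 = G"
    using nz(2) unfolding s1_def G_def d1_def by (simp add: field_simps)
  have m: "m \<noteq> 0" using nz alpha_nonzero by (simp add: m_def)
  have t': "t / m = G * (a * (e / d)\<^sup>2 - b * (e / d) + c)"
    using m unfolding t G_def by simp
  have rels: "\<alpha> * h = \<beta> * G" "\<alpha> * p0 = s0" "\<beta> = \<alpha> * \<alpha> - 1"
    using alpha_nonzero by (simp_all add: h_def p0_def \<beta>_def power2_eq_square)
  define x where "x = e / d"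
  have e: "e = d * x" using nz(1) by (simp add: x_def)
  have Ga: "G * a = \<alpha> * d * s1"
    unfolding G_def s1_def by simp
  have Gb: "G * b = d * s0 + \<alpha> * e * s1"
    using nz unfolding G_def s1_def s0_def by (simp add: field_simps)
  have Gx: "G * (a * (x * x) - b * x) = - (e * s0)"
  proof -
    have "G * (a * (x * x) - b * x) = (G * a) * (x * x) - (G * b) * x" by (simp add: algebra_simps)
    then show ?thesis unfolding Ga Gb e by (simp add: algebra_simps)
  qed
  have \<gamma>: "\<gamma> = G + s1" using G by (simp add: algebra_simps)
  have main: "raise (quad a b c) (lin d e) (lin p1 p0 * Dx g + K \<gamma> * Sx g) - K (t / m) * g
    = pearson (quad a b c) (lin d e) (\<sigma> * Sx g + \<tau> * Dx g)"
  proof (rule raise_eq_pearson)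
    show "Dx \<tau> = Sx (lin p1 p0) + (K \<gamma> - Dx \<sigma>) * U1 - K \<alpha> * Sx \<sigma>"
      unfolding \<sigma>_def \<tau>_def quad_simps power2_eq_square
      by (rule quad_cong; (rule refl | (use rels G p1_def in algebra)))
    show "Sx \<tau> = U2 * (Dx (lin p1 p0) + K \<alpha> * (K \<gamma> - Dx \<sigma>)) - U1 * Sx \<sigma>"
      unfolding \<sigma>_def \<tau>_def quad_simps power2_eq_square
      by (rule quad_cong; (rule refl | (use rels G p1_def in algebra)))
    show "K \<gamma> * quad a b c - K (t / m) = quad a b c * Dx \<sigma> + lin d e * Sx \<sigma>"
      unfolding \<sigma>_def t'[folded x_def] quad_simps power2_eq_square \<gamma>
      by (rule quad_cong; use Ga Gb Gx in \<open>simp add: algebra_simps\<close>)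
  qed
  have "K m * (raise (quad a b c) (lin d e) (lin p1 p0 * Dx g + K \<gamma> * Sx g) - K (t / m) * g)
    = raise (quad a b c) (lin d e) (K \<alpha> * lin d2 (b + \<alpha> * e) * Dx g + (lin (m * A) (- s) * Dx g + K (m * \<gamma>) * Sx g)) - K t * g"
  proof -
    have "K \<alpha> * lin d2 (b + \<alpha> * e) + lin (m * A) (- s) = K m * lin p1 p0"
      unfolding quad_simps using p1 p0 by (intro quad_cong) simp_all
    then have "K \<alpha> * lin d2 (b + \<alpha> * e) * Dx g + (lin (m * A) (- s) * Dx g + K (m * \<gamma>) * Sx g)
      = K m * (lin p1 p0 * Dx g + K \<gamma> * Sx g)"
      unfolding K_mult by algebra
    moreover have "K t = K m * K (t / m)" using m by (simp flip: K_mult)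
    ultimately show ?thesis by (simp only: raise_K_mult right_diff_distrib mult.assoc)
  qed
  then show ?thesis unfolding main pearson_K_mult[symmetric] by metis
qed

section \<open>Iterates of \<open>Dx\<close> and the coefficient sequences\<close>

lemma gamma_seq_Suc: "gamma_seq (Suc n) = \<alpha> * gamma_seq n + alpha_seq n"
  and alpha_seq_Suc: "alpha_seq (Suc n) = \<alpha> * alpha_seq n + \<beta> * gamma_seq n"
  using gamma_seq_add[of n 1] alpha_seq_add[of n 1] by simp_all

lemma alpha_gamma_pythagoras: "(alpha_seq n)\<^sup>2 - \<beta> * (gamma_seq n)\<^sup>2 = 1"
proof (induction n)
  case (Suc n)
  have "(alpha_seq (Suc n))\<^sup>2 - \<beta> * (gamma_seq (Suc n))\<^sup>2
    = (\<alpha>\<^sup>2 - \<beta>) * ((alpha_seq n)\<^sup>2 - \<beta> * (gamma_seq n)\<^sup>2)"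
    unfolding gamma_seq_Suc alpha_seq_Suc by (simp add: power2_eq_square algebra_simps)
  then show ?case using Suc by (simp add: \<beta>_def)
qed simp

text \<open>A Leibniz rule: one more \<open>Dx\<close>, moved past \<open>Sx\<close> by
  \<open>Dx_Sx_commute\<close>, transforms the two coefficients by the recurrences
  \<open>gamma_seq_Suc\<close> and \<open>alpha_seq_Suc\<close>.\<close>

lemma funpow_Dx_Y_mult:
  "(Dx ^^ Suc k) (Y * f) = K (gamma_seq (Suc k)) * Sx ((Dx ^^ k) f) + K (alpha_seq (Suc k)) * (Y * Dx ((Dx ^^ k) f))"
proof (induction k)
  case 0
  show ?case by (simp add: Dx_mult Dx_Y Sx_Y K_hom)
next
  case (Suc k)
  have "(Dx ^^ Suc (Suc k)) (Y * f) = Dx ((Dx ^^ Suc k) (Y * f))" by simp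
  also have "\<dots> = Dx (K (gamma_seq (Suc k)) * Sx ((Dx ^^ k) f) + K (alpha_seq (Suc k)) * (Y * Dx ((Dx ^^ k) f)))"
    by (simp only: Suc)
  also have "\<dots> = K (gamma_seq (Suc (Suc k))) * Sx (Dx ((Dx ^^ k) f))
    + K (alpha_seq (Suc (Suc k))) * (Y * Dx (Dx ((Dx ^^ k) f)))"
    unfolding gamma_seq_Suc[of "Suc k"] alpha_seq_Suc[of "Suc k"] K_hom Dx_simps Sx_simps Dx_Sx_commute U1_eq
    by algebra
  finally show ?case by simp
qed

lemma funpow_Dx_add: "(Dx ^^ k) (f + g) = (Dx ^^ k) f + (Dx ^^ k) g"
  by (induction k) (simp_all add: Dx_add)

lemma funpow_Dx_K_mult: "(Dx ^^ k) (K c * f) = K c * (Dx ^^ k) f"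
  by (induction k) (simp_all add: Dx_mult Dx_const Sx_const)

lemma funpow_dual_Dx: "(dual_Dx ^^ n) v f = (- 1) ^ n * v ((Dx ^^ n) f)"
proof (induction n arbitrary: f)
  case (Suc n)
  have "(dual_Dx ^^ Suc n) v f = - (dual_Dx ^^ n) v (Dx f)" by (simp add: dual_Dx_def)
  also have "\<dots> = (- 1) ^ Suc n * v ((Dx ^^ Suc n) f)" by (simp add: Suc funpow_swap1)
  finally show ?case .
qed simp

lemma poly_dual_iff:
  "w \<in> poly_dual \<longleftrightarrow> (\<forall>f g. w (f + g) = w f + w g) \<and> (\<forall>k f. w (K k * f) = k * w f)"
proof -
  have "vector_space (smult :: complex \<Rightarrow> _)" "vector_space ((*) :: complex \<Rightarrow> _)"
    by unfold_locales (simp_all add: algebra_simps smult_add_left smult_add_right)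
  then show ?thesis
    by (auto simp: poly_dual_def Vector_Spaces.linear_def module_hom_def module_hom_axioms_def
        vector_space_def module_def K_def)
qed

lemma poly_dual_minus: "w \<in> poly_dual \<Longrightarrow> w (- f) = - w f"
  using poly_dual_iff[of w, THEN iffD1, THEN conjunct2, rule_format, of "-1" f] by (simp add: K_hom)

lemma poly_dual_diff: "w \<in> poly_dual \<Longrightarrow> w (f - g) = w f - w g"
  using poly_dual_iff[of w] poly_dual_minus[of w g] by (metis add_uminus_conv_diff)

lemma raise_add: "raise \<phi> \<psi> (f + g) = raise \<phi> \<psi> f + raise \<phi> \<psi> g"
  by (simp add: raise_def Dx_simps Sx_simps algebra_simps)

text \<open>Companion of \<open>d_seq\<close>: the pair (a_k, d_k) is the k-th iterate of the
  hyperbolic rotation (a, d) -> (\<alpha> a + \<beta> d, a + \<alpha> d). \<open>b_seq\<close>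
  accompanies \<open>e_seq\<close> in the same way.\<close>

definition a_seq :: "complex poly \<Rightarrow> complex poly \<Rightarrow> nat \<Rightarrow> complex" where
  "a_seq \<phi> \<psi> k = 1/2 * poly (pderiv (pderiv \<phi>)) 0 * alpha_seq k + \<beta> * poly (pderiv \<psi>) 0 * gamma_seq k"

definition b_seq :: "complex poly \<Rightarrow> complex poly \<Rightarrow> nat \<Rightarrow> complex" where
  "b_seq \<phi> \<psi> k = poly (pderiv \<phi>) c3 * alpha_seq k + \<beta> * poly \<psi> c3 * gamma_seq k"

lemma seq_0:
  "a_seq \<phi> \<psi> 0 = 1/2 * poly (pderiv (pderiv \<phi>)) 0" "d_seq \<phi> \<psi> 0 = poly (pderiv \<psi>) 0"
  "b_seq \<phi> \<psi> 0 = poly (pderiv \<phi>) c3" "e_seq \<phi> \<psi> 0 = poly \<psi> c3"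
  by (simp_all add: a_seq_def b_seq_def d_seq_def e_seq_def)

lemma seq_Suc:
  "d_seq \<phi> \<psi> (Suc k) = a_seq \<phi> \<psi> k + \<alpha> * d_seq \<phi> \<psi> k"
  "a_seq \<phi> \<psi> (Suc k) = \<alpha> * a_seq \<phi> \<psi> k + \<beta> * d_seq \<phi> \<psi> k"
  "e_seq \<phi> \<psi> (Suc k) = b_seq \<phi> \<psi> k + \<alpha> * e_seq \<phi> \<psi> k"
  "b_seq \<phi> \<psi> (Suc k) = \<alpha> * b_seq \<phi> \<psi> k + \<beta> * e_seq \<phi> \<psi> k"
  unfolding a_seq_def b_seq_def d_seq_def e_seq_def gamma_seq_Suc alpha_seq_Suc
  by (simp_all add: algebra_simps)

text \<open>The two brackets equal -gamma_k and alpha_k, so the left side rotates (a_{2k}, d_{2k})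
  back by k steps; the rotation has determinant 1 by \<open>alpha_gamma_pythagoras\<close>.\<close>

lemma d_seq_half:
  fixes k :: nat
  defines "A \<equiv> alpha_seq (Suc k)" and "\<gamma> \<equiv> gamma_seq (Suc k)"
  shows "a_seq \<phi> \<psi> (2 * k) * (A - \<alpha> * \<gamma>) + d_seq \<phi> \<psi> (2 * k) * (\<alpha> * A - \<beta> * \<gamma>) = d_seq \<phi> \<psi> k"
proof -
  define a d g c where "a = 1/2 * poly (pderiv (pderiv \<phi>)) 0" "d = poly (pderiv \<psi>) 0"
    "g = gamma_seq k" "c = alpha_seq k"
  note v = this
  have "A - \<alpha> * \<gamma> = - g" "\<alpha> * A - \<beta> * \<gamma> = c"
    unfolding A_def \<gamma>_def gamma_seq_Suc alpha_seq_Suc v \<beta>_def by (simp_all add: algebra_simps power2_eq_square)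
  moreover have "a_seq \<phi> \<psi> (2 * k) = a * (c * c + \<beta> * g * g) + \<beta> * d * (2 * g * c)"
    "d_seq \<phi> \<psi> (2 * k) = a * (2 * g * c) + d * (c * c + \<beta> * g * g)"
    unfolding a_seq_def d_seq_def mult_2[of k] gamma_seq_add alpha_seq_add v
    by (simp_all add: algebra_simps)
  moreover have "d_seq \<phi> \<psi> k = a * g + d * c" by (simp add: d_seq_def v)
  moreover have "c * c - \<beta> * (g * g) = 1"
    using alpha_gamma_pythagoras[of k] by (simp add: v power2_eq_square)
  ultimately show ?thesis by algebra
qed

section \<open>The functionals of an admissible pair and their recurrence\<close>

context
  fixes \<phi> \<psi> :: "complex poly" and u :: "complex poly \<Rightarrow> complex"
  assumes u: "u \<in> poly_dual" and admissible: "x_admissible \<phi> \<psi>"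
    and functional_eq: "dual_Dx (\<phi> \<odot> u) = dual_Sx (\<psi> \<odot> u)"
begin

lemma phi_eq_quad: "\<phi> = quad (a_seq \<phi> \<psi> 0) (b_seq \<phi> \<psi> 0) (poly \<phi> c3)"
  and psi_eq_lin: "\<psi> = lin (d_seq \<phi> \<psi> 0) (e_seq \<phi> \<psi> 0)"
proof -
  have "degree \<phi> \<le> 2" "degree \<psi> \<le> 1" using admissible by (auto simp: x_admissible_def)
  then have "\<phi> = [:coeff \<phi> 0, coeff \<phi> 1, coeff \<phi> 2:]" "\<psi> = [:coeff \<psi> 0, coeff \<psi> 1:]"
    by (auto intro!: poly_eqI simp: coeff_pCons coeff_eq_0 numeral_2_eq_2 split: nat.split)
  then obtain x0 x1 x2 y0 y1 where "\<phi> = [:x0, x1, x2:]" "\<psi> = [:y0, y1:]" by blast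
  then show "\<phi> = quad (a_seq \<phi> \<psi> 0) (b_seq \<phi> \<psi> 0) (poly \<phi> c3)"
    "\<psi> = lin (d_seq \<phi> \<psi> 0) (e_seq \<phi> \<psi> 0)"
    by (simp_all add: seq_0 quad_def lin_def K_def Y_def pderiv_pCons algebra_simps)
qed

lemma d_seq_nonzero: "d_seq \<phi> \<psi> n \<noteq> 0"
  using admissible unfolding x_admissible_def d_seq_def by (simp add: algebra_simps)

text \<open>The constant coefficient of phi^[k] stays anonymous, since t_n refers to it only through
  a value of phi^[n-1].\<close>

lemma phi_psi_seq:
  "psi_seq \<phi> \<psi> k = lin (d_seq \<phi> \<psi> (2 * k)) (e_seq \<phi> \<psi> k)"
  "\<exists>ck. phi_seq \<phi> \<psi> k = quad (a_seq \<phi> \<psi> (2 * k)) (b_seq \<phi> \<psi> k) ck"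
proof -
  have "psi_seq \<phi> \<psi> k = lin (d_seq \<phi> \<psi> (2 * k)) (e_seq \<phi> \<psi> k) \<and>
    (\<exists>ck. phi_seq \<phi> \<psi> k = quad (a_seq \<phi> \<psi> (2 * k)) (b_seq \<phi> \<psi> k) ck)"
  proof (induction k)
    case 0
    show ?case using phi_eq_quad psi_eq_lin by auto
  next
    case (Suc k)
    then obtain ck where IH: "psi_seq \<phi> \<psi> k = lin (d_seq \<phi> \<psi> (2 * k)) (e_seq \<phi> \<psi> k)"
      "phi_seq \<phi> \<psi> k = quad (a_seq \<phi> \<psi> (2 * k)) (b_seq \<phi> \<psi> k) ck" by blast
    have S: "psi_seq \<phi> \<psi> (Suc k) = psi_next (phi_seq \<phi> \<psi> k) (psi_seq \<phi> \<psi> k)"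
      "phi_seq \<phi> \<psi> (Suc k) = phi_next (phi_seq \<phi> \<psi> k) (psi_seq \<phi> \<psi> k)"
      by (simp_all add: psi_next_def phi_next_def)
    have k: "2 * Suc k = Suc (Suc (2 * k))" by simp
    have D: "d_seq \<phi> \<psi> (2 * Suc k) = 2 * \<alpha> * a_seq \<phi> \<psi> (2 * k) + (2 * \<alpha>\<^sup>2 - 1) * d_seq \<phi> \<psi> (2 * k)"
      "a_seq \<phi> \<psi> (2 * Suc k) = (2 * \<alpha>\<^sup>2 - 1) * a_seq \<phi> \<psi> (2 * k) + 2 * \<alpha> * \<beta> * d_seq \<phi> \<psi> (2 * k)"
      unfolding k seq_Suc \<beta>_def by (simp_all add: power2_eq_square algebra_simps)
    show ?case
      unfolding S IH psi_next_quad phi_next_quad D seq_Suc(3,4) by blast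
  qed
  then show "psi_seq \<phi> \<psi> k = lin (d_seq \<phi> \<psi> (2 * k)) (e_seq \<phi> \<psi> k)"
    "\<exists>ck. phi_seq \<phi> \<psi> k = quad (a_seq \<phi> \<psi> (2 * k)) (b_seq \<phi> \<psi> k) ck" by blast+
qed

lemma u_seq_Suc: "u_seq \<phi> \<psi> u (Suc k) f = - u_seq \<phi> \<psi> u k (raise (phi_seq \<phi> \<psi> k) (psi_seq \<phi> \<psi> k) f)"
  if "u_seq \<phi> \<psi> u k \<in> poly_dual"
  using that unfolding poly_dual_iff
  by (simp add: dual_Dx_def dual_Sx_def poly_mult_fun_def raise_def mult.commute)

lemma u_seq_dual: "u_seq \<phi> \<psi> u k \<in> poly_dual"
proof (induction k)
  case (Suc k)
  then show ?case
    unfolding poly_dual_iff[of "u_seq \<phi> \<psi> u (Suc k)"] u_seq_Suc[OF Suc]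
    by (simp add: raise_add raise_K_mult poly_dual_iff)
qed (use u in simp)

text \<open>The base case is the functional equation; in the step, \<open>pearson_next\<close> moves
  A_k L_{k+1} f into the range of L_k.\<close>

lemma u_seq_pearson: "u_seq \<phi> \<psi> u k (pearson (phi_seq \<phi> \<psi> k) (psi_seq \<phi> \<psi> k) f) = 0"
proof (induction k arbitrary: f)
  case 0
  have "- u (Dx f * \<phi>) = u (Sx f * \<psi>)"
    using functional_eq by (auto simp: dual_Dx_def dual_Sx_def poly_mult_fun_def dest: fun_cong)
  then show ?case using u unfolding poly_dual_iff
    by (simp add: pearson_def mult.commute neg_eq_iff_add_eq_0)
next
  case (Suc k)
  obtain ck where "phi_seq \<phi> \<psi> k = quad (a_seq \<phi> \<psi> (2 * k)) (b_seq \<phi> \<psi> k) ck"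
    using phi_psi_seq(2) by blast
  note \<phi>\<psi> = this phi_psi_seq(1)[of k]
  have S: "psi_seq \<phi> \<psi> (Suc k) = psi_next (phi_seq \<phi> \<psi> k) (psi_seq \<phi> \<psi> k)"
    "phi_seq \<phi> \<psi> (Suc k) = phi_next (phi_seq \<phi> \<psi> k) (psi_seq \<phi> \<psi> k)"
    by (simp_all add: psi_next_def phi_next_def)
  obtain g where "raise (phi_seq \<phi> \<psi> k) (psi_seq \<phi> \<psi> k) (pearson (phi_seq \<phi> \<psi> (Suc k)) (psi_seq \<phi> \<psi> (Suc k)) f)
    = pearson (phi_seq \<phi> \<psi> k) (psi_seq \<phi> \<psi> k) g"
    unfolding S \<phi>\<psi> using pearson_next by blast
  then show ?case unfolding u_seq_Suc[OF u_seq_dual] using Suc[of g] by simp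
qed

lemma funpow_dual_Dx_recurrence:
  "(dual_Dx ^^ Suc (Suc k)) (u_seq \<phi> \<psi> u (Suc (Suc k))) f =
     (dual_Dx ^^ Suc k) (u_seq \<phi> \<psi> u (Suc k)) (f * [:- rec_s \<phi> \<psi> (Suc k), rec_a \<phi> \<psi> (Suc k):])
     - rec_t \<phi> \<psi> (Suc k) * (dual_Dx ^^ k) (u_seq \<phi> \<psi> u k) f"
proof -
  define w g where "w = u_seq \<phi> \<psi> u k" "g = (Dx ^^ k) f"
  define A \<gamma> where "A = alpha_seq (Suc k)" "\<gamma> = gamma_seq (Suc k)"
  \<comment> \<open>The shift by m c3 rewrites a_n z - s_n as m \<open>Y\<close> - s.\<close>
  define m s t where "m = rec_a \<phi> \<psi> (Suc k)" "s = rec_s \<phi> \<psi> (Suc k) - m * c3" "t = rec_t \<phi> \<psi> (Suc k)"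
  note v = \<open>w = _\<close> \<open>g = _\<close> \<open>A = _\<close> \<open>\<gamma> = _\<close> \<open>m = _\<close> \<open>s = _\<close> \<open>t = _\<close>
  define a b d e where "a = a_seq \<phi> \<psi> (2 * k)" "b = b_seq \<phi> \<psi> k" "d = d_seq \<phi> \<psi> (2 * k)" "e = e_seq \<phi> \<psi> k"
  note abde = this
  obtain ck where \<phi>: "phi_seq \<phi> \<psi> k = quad a b ck" using phi_psi_seq(2) abde by metis
  have \<psi>: "psi_seq \<phi> \<psi> k = lin d e" using phi_psi_seq(1) abde by metis
  let ?raise = "raise (quad a b ck) (lin d e)"
  have w: "w \<in> poly_dual" unfolding v by (rule u_seq_dual)
  have ann: "w (pearson (quad a b ck) (lin d e) f) = 0" for f
    using u_seq_pearson[of k f] unfolding \<phi> \<psi> v .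
  define d1 d2 dk where "d1 = d_seq \<phi> \<psi> (2 * k + 1)" "d2 = d_seq \<phi> \<psi> (2 * k + 2)" "dk = d_seq \<phi> \<psi> k"
  note dd = this
  have dd': "d1 = a + \<alpha> * d" "d2 = 2 * \<alpha> * a + (2 * \<alpha>\<^sup>2 - 1) * d"
    "dk = a * (A - \<alpha> * \<gamma>) + d * (\<alpha> * A - \<beta> * \<gamma>)" "e_seq \<phi> \<psi> (Suc k) = b + \<alpha> * e"
    using d_seq_half[of \<phi> \<psi> k]
    by (simp_all add: dd abde v seq_Suc \<beta>_def algebra_simps power2_eq_square)
  have nz: "d \<noteq> 0" "d1 \<noteq> 0" "d2 \<noteq> 0" "dk \<noteq> 0" unfolding abde dd by (rule d_seq_nonzero)+
  have m: "m = - \<alpha> * d2 * d1 / dk" unfolding v dd rec_a_def by simp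
  have s: "s = m * (\<gamma> * e / d - (\<alpha> * \<gamma> + A) * (b + \<alpha> * e) / d2)"
    unfolding dd'(4)[symmetric] unfolding v gamma_seq_Suc[of "Suc k", symmetric] dd abde rec_s_def
    by (simp add: right_diff_distrib distrib_left)
  have t: "t = m * (\<alpha> * \<gamma> * d / d1) * (a * (e / d)\<^sup>2 - b * (e / d) + ck)"
  proof -
    have idx: "Suc k - 1 = k" "2 * Suc k - 2 = 2 * k" "2 * Suc k - 1 = 2 * k + 1" by simp_all
    have "poly (quad a b ck) (c3 - x) = a * x\<^sup>2 - b * x + ck" for x
      by (simp add: quad_def K_def Y_def power2_eq_square algebra_simps)
    then show ?thesis
      unfolding v(7) rec_t_def idx \<phi> v(4,5) abde(3,4) dd(1) by metis
  qed
  have "\<exists>h. ?raise (K \<alpha> * lin d2 (b + \<alpha> * e) * Dx g + (lin (m * A) (- s) * Dx g + K (m * \<gamma>) * Sx g)) - K t * g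
    = pearson (quad a b ck) (lin d e) h"
    using nz s t unfolding m unfolding dd'(1-3) by (rule raise_next)
  then obtain h where h: "?raise (K \<alpha> * lin d2 (b + \<alpha> * e) * Dx g + (lin (m * A) (- s) * Dx g + K (m * \<gamma>) * Sx g)) - K t * g
    = pearson (quad a b ck) (lin d e) h" ..
  have lower: "w (?raise (lin (m * A) (- s) * Dx g + K (m * \<gamma>) * Sx g))
    = t * w g - w (?raise (K \<alpha> * lin d2 (b + \<alpha> * e) * Dx g))"
    using ann[of h] w unfolding h[symmetric] raise_add poly_dual_diff[OF w]
    by (simp add: poly_dual_iff algebra_simps)
  define \<phi>' \<psi>' where "\<phi>' = phi_next (quad a b ck) (lin d e)" "\<psi>' = psi_next (quad a b ck) (lin d e)"
  note nxt = this
  have S: "psi_seq \<phi> \<psi> (Suc k) = \<psi>'" "phi_seq \<phi> \<psi> (Suc k) = \<phi>'"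
    by (simp_all add: psi_next_def phi_next_def nxt \<phi> \<psi>)
  have \<psi>': "\<psi>' = lin d2 (b + \<alpha> * e)" unfolding nxt psi_next_quad dd'(2) ..
  \<comment> \<open>\<open>raise_Dx\<close> at level k + 1 leaves a term in the range of L_{k+1};
    A_k carries it into the range of L_k, where w vanishes.\<close>
  obtain h' where h': "?raise (pearson \<phi>' \<psi>' (K \<alpha> * Sx (Dx g) - U1 * Dx (Dx g))) = pearson (quad a b ck) (lin d e) h'"
    using pearson_next unfolding nxt by blast
  have "w (?raise (raise \<phi>' \<psi>' (Dx (Dx g)))) = - w (?raise (K \<alpha> * lin d2 (b + \<alpha> * e) * Dx g))"
    unfolding raise_Dx raise_diff poly_dual_diff[OF w] h' ann unfolding \<psi>' by simp
  with lower have *: "w (?raise (raise \<phi>' \<psi>' (Dx (Dx g))))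
    = w (?raise (lin (m * A) (- s) * Dx g + K (m * \<gamma>) * Sx g)) - t * w g" by simp
  have "f * [:- rec_s \<phi> \<psi> (Suc k), rec_a \<phi> \<psi> (Suc k):] = K m * (Y * f) + K (- s) * f"
    unfolding v(5,6) by (simp add: Y_def K_def algebra_simps smult_diff_left smult_diff_right)
  then have "(Dx ^^ Suc k) (f * [:- rec_s \<phi> \<psi> (Suc k), rec_a \<phi> \<psi> (Suc k):])
    = K m * (K \<gamma> * Sx g + K A * (Y * Dx g)) + K (- s) * Dx g"
    unfolding v(2-4) by (simp only: funpow_Dx_add funpow_Dx_K_mult funpow_Dx_Y_mult) simp
  also have "\<dots> = lin (m * A) (- s) * Dx g + K (m * \<gamma>) * Sx g"
    unfolding lin_def K_hom by algebra
  finally have lower_arg: "(Dx ^^ Suc k) (f * [:- rec_s \<phi> \<psi> (Suc k), rec_a \<phi> \<psi> (Suc k):]) = \<dots>" .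
  have "(Dx ^^ Suc (Suc k)) f = Dx (Dx g)" by (simp add: v(2))
  \<comment> \<open>All three terms carry the sign (-1)^k once \<open>u_seq_Suc\<close> has been
    applied twice, once and not at all, respectively.\<close>
  then show ?thesis
    unfolding funpow_dual_Dx lower_arg using *
    by (simp add: u_seq_Suc[OF u_seq_dual] S \<phi> \<psi> right_diff_distrib
        del: funpow.simps u_seq.simps phi_seq.simps psi_seq.simps flip: v(1,2,7))
qed

lemma R_poly_eq: "R_poly \<phi> \<psi> n \<odot> u = (dual_Dx ^^ n) (u_seq \<phi> \<psi> u n)"
proof (induction n rule: induct_nat_012)
  case 0
  show ?case by (simp add: poly_mult_fun_def)
next
  case 1
  show ?case
  proof
    fix f
    have d: "- rec_s \<phi> \<psi> 0 = - \<alpha> * coeff \<psi> 0" "rec_a \<phi> \<psi> 0 = - \<alpha> * coeff \<psi> 1"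
      by (simp_all add: rec_s_def rec_a_def)
    have "degree \<psi> \<le> 1" using admissible by (auto simp: x_admissible_def)
    then have "[:coeff \<psi> 0, coeff \<psi> 1:] = \<psi>"
      by (intro poly_eqI) (auto simp: coeff_pCons coeff_eq_0 split: nat.split)
    moreover have l: "[:- \<alpha> * coeff \<psi> 0, - \<alpha> * coeff \<psi> 1:] = K (- \<alpha>) * [:coeff \<psi> 0, coeff \<psi> 1:]"
      by (simp add: K_def)
    \<comment> \<open>The special values at index 0 make R_1 = -\<alpha> \<psi>, which is what
      \<open>raise_Dx\<close> yields modulo the range of L_0.\<close>
    ultimately have R: "R_poly \<phi> \<psi> (Suc 0) = K (- \<alpha>) * \<psi>"
      by (metis R_poly.simps(1,2) d l mult_1_right)
    show "(R_poly \<phi> \<psi> (Suc 0) \<odot> u) f = (dual_Dx ^^ Suc 0) (u_seq \<phi> \<psi> u (Suc 0)) f"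
      using u_seq_pearson[of 0 "K \<alpha> * Sx f - U1 * Dx f"] u
      unfolding funpow_dual_Dx u_seq_Suc[OF u_seq_dual] poly_mult_fun_def R
      by (simp add: raise_Dx poly_dual_diff K_hom poly_dual_minus algebra_simps)
  qed
next
  case (ge2 n)
  have "(R_poly \<phi> \<psi> (Suc (Suc n)) \<odot> u) f
    = (R_poly \<phi> \<psi> (Suc n) \<odot> u) (f * [:- rec_s \<phi> \<psi> (Suc n), rec_a \<phi> \<psi> (Suc n):])
      - rec_t \<phi> \<psi> (Suc n) * (R_poly \<phi> \<psi> n \<odot> u) f" for f
  proof -
    define l where "l = [:- rec_s \<phi> \<psi> (Suc n), rec_a \<phi> \<psi> (Suc n):]"
    have "f * (l * R_poly \<phi> \<psi> (Suc n) - K k * R_poly \<phi> \<psi> n)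
      = (f * l) * R_poly \<phi> \<psi> (Suc n) - K k * (f * R_poly \<phi> \<psi> n)" for k
      by (simp add: algebra_simps)
    then show ?thesis
      using u unfolding poly_mult_fun_def R_poly.simps smult_eq_K l_def[symmetric]
      by (simp add: poly_dual_diff poly_dual_iff)
  qed
  then show ?case unfolding ge2 funpow_dual_Dx_recurrence[symmetric] by blast
qed

lemma rec_a_nonzero: "rec_a \<phi> \<psi> n \<noteq> 0"
proof -
  have "coeff \<psi> 1 = d_seq \<phi> \<psi> 0" by (simp add: seq_0 poly_0_coeff_0 coeff_pderiv)
  then show ?thesis using alpha_nonzero d_seq_nonzero by (simp add: rec_a_def)
qed

text \<open>Admissibility makes every a_n nonzero, so each step raises the degree by exactly
  one.\<close>

lemma degree_R_poly: "degree (R_poly \<phi> \<psi> n) = n"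
proof (induction n rule: induct_nat_012)
  case (ge2 n)
  define l where "l = [:- rec_s \<phi> \<psi> (Suc n), rec_a \<phi> \<psi> (Suc n):]"
  have "degree l = 1" "l \<noteq> 0" using rec_a_nonzero by (simp_all add: l_def)
  moreover have "R_poly \<phi> \<psi> (Suc n) \<noteq> 0" using ge2(2) by auto
  ultimately have "degree (l * R_poly \<phi> \<psi> (Suc n)) = Suc (Suc n)"
    using ge2(2) by (simp add: degree_mult_eq)
  moreover have "degree (smult (rec_t \<phi> \<psi> (Suc n)) (R_poly \<phi> \<psi> n)) < Suc (Suc n)"
    using degree_smult_le[of "rec_t \<phi> \<psi> (Suc n)" "R_poly \<phi> \<psi> n"] ge2(1) by simp
  ultimately show ?case
    unfolding R_poly.simps l_def[symmetric] diff_conv_add_uminus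
    by (subst degree_add_eq_left) simp_all
qed (use rec_a_nonzero in simp_all)

end

end

theorem theorem3p1:
  fixes q :: real and c1 c2 c3 :: complex
    and \<phi> \<psi> :: "complex poly" and u :: "complex poly \<Rightarrow> complex"
  assumes "q > 0" and "q \<noteq> 1" and "(c1, c2) \<noteq> (0, 0)"
    and "u \<in> poly_dual"
    and "q_lattice.x_admissible q \<phi> \<psi>"
    and "q_lattice.dual_Dx q c1 c2 c3 (\<phi> \<odot> u) = q_lattice.dual_Sx q c1 c2 c3 (\<psi> \<odot> u)"
  shows "(\<forall>n. degree (q_lattice.R_poly q c1 c2 c3 \<phi> \<psi> n) = n) \<and>
    (\<forall>n. q_lattice.R_poly q c1 c2 c3 \<phi> \<psi> n \<odot> u =
       (q_lattice.dual_Dx q c1 c2 c3 ^^ n) (q_lattice.u_seq q c1 c2 c3 \<phi> \<psi> u n))"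
proof -
  interpret nondegenerate_q_lattice q c1 c2 c3
    using assms by unfold_locales
  show ?thesis using degree_R_poly R_poly_eq assms(4-6) by blast
qed

end
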